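(* Let $N\ge 3$, let $m_1,\dots,m_N$ be positive masses, assume that the potential $V$ is attractive or repulsive, and let $\mathbf q=(\mathbf q_1,\dots,\mathbf q_N)\in Q$ be a Dziobek configuration in $\mathbb S^{N-2}$ with masses $m_1,\dots,m_N$. Then $\mathbf q$ is an equilibrium configuration if and only if $\Delta_N\neq 0$ and the following system of equations is satisfied: $$m_k=\frac{S_{1N}\Delta_k}{S_{1k}\Delta_N}\,m_N\quad (k=2,\dots,N-1),\qquad m_1=\frac{S_{2N}\Delta_1}{S_{12}\Delta_N}\,m_N,$$ $$S_{1j}S_{2N}=S_{12}S_{jN},\qquad j=3,\dots,N-1,$$ $$S_{jk}S_{1N}=S_{1k}S_{jN},\qquad j=2,\dots,N-2,\ k=j+1,\dots,N-1.$$
   Context: $\mathbb S^{N-2}$ is the unit sphere of $\mathbb R^{N-1}$. For points $\mathbf q_i,\mathbf q_j$ on it, $d_{ij}\in[0,\pi]$ is the geodesic distance, $\cos d_{ij}=\mathbf q_i\cdot \mathbf q_j$. $G:(0,\pi)\to\mathbb R$ is a given smooth function and $Q$ is the set of configurations $\mathbf q=(\mathbf q_1,\dots,\mathbf q_N)\in(\mathbb S^{N-2})^N$ with $d_{ij}\in(0,\pi)$ for all $i\ne j$. The potential is $V(\mathbf q)=\sum_{1\le i<j\le N}m_im_jG(d_{ij})$; it is attractive if $G'>0$ on $(0,\pi)$ and repulsive if $G'<0$ on $(0,\pi)$. A configuration $\mathbf q\in Q$ is an equilibrium configuration if it is a critical point of $V$ on $Q$, i.e. if $$\sum_{j=1,j\ne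 i}^N\frac{m_im_jG'(d_{ij})}{\sin d_{ij}}\,[\mathbf q_j-\cos d_{ij}\,\mathbf q_i]=0,\qquad i=1,\dots,N.$$ Set $S_{ij}=\frac{G'(d_{ij})}{\sin d_{ij}}$ for $i\neq j$. A configuration of $N$ bodies is a Dziobek configuration if $\operatorname{rank}(\mathbf q_1,\dots,\mathbf q_N)=N-1$. Let $X=[\mathbf q_1,\dots,\mathbf q_N]$ be the $(N-1)\times N$ matrix with columns $\mathbf q_i$, let $X_k$ be the square matrix obtained from $X$ by deleting the $k$-th column, and let $\Delta_k=(-1)^{k+1}\det X_k$. *)

theory Defs
  imports "HOL-Analysis.Derivative" "Jordan_Normal_Form.DL_Rank"
begin

unbundle no vec_syntax
unbundle no inner_syntax

text \<open>
  The bodies are labelled by 1 to N; a configuration is a function on \<open>nat\<close> of which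
  only the values at these labels matter.  Vectors and matrices carry their dimension explicitly.
\<close>

definition unit_sphere :: "nat \<Rightarrow> real vec set" where
  "unit_sphere n = {v \<in> carrier_vec n. v \<bullet> v = 1}"

definition geo_dist :: "real vec \<Rightarrow> real vec \<Rightarrow> real" where
  "geo_dist u v = arccos (u \<bullet> v)"

definition config_space :: "nat \<Rightarrow> (nat \<Rightarrow> real vec) set" where
  "config_space N = {q. (\<forall>i\<in>{1..N}. q i \<in> unit_sphere (N - 1)) \<and>
     (\<forall>i\<in>{1..N}. \<forall>j\<in>{1..N}. i \<noteq> j \<longrightarrow> geo_dist (q i) (q j) \<in> {0<..<pi})}"

text \<open>Only the values of \<open>G\<close> on the open interval from 0 to \<open>pi\<close> are used anywhere below.\<close>

definition smooth_on_0_pi :: "(real \<Rightarrow> real) \<Rightarrow> bool" where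
  "smooth_on_0_pi G \<longleftrightarrow> (\<forall>n. \<forall>x\<in>{0<..<pi}. (deriv ^^ n) G differentiable (at x))"

definition attractive :: "(real \<Rightarrow> real) \<Rightarrow> bool" where
  "attractive G \<longleftrightarrow> (\<forall>x\<in>{0<..<pi}. deriv G x > 0)"

definition repulsive :: "(real \<Rightarrow> real) \<Rightarrow> bool" where
  "repulsive G \<longleftrightarrow> (\<forall>x\<in>{0<..<pi}. deriv G x < 0)"

definition potential ::
  "nat \<Rightarrow> (nat \<Rightarrow> real) \<Rightarrow> (real \<Rightarrow> real) \<Rightarrow> (nat \<Rightarrow> real vec) \<Rightarrow> real" where
  "potential N m G q = (\<Sum>i=1..N. \<Sum>j=i+1..N. m i * m j * G (geo_dist (q i) (q j)))"

definition config_curve :: "nat \<Rightarrow> (real \<Rightarrow> nat \<Rightarrow> real vec) \<Rightarrow> (nat \<Rightarrow> real vec) \<Rightarrow> bool" where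
  "config_curve N c q \<longleftrightarrow> c 0 = q \<and> (\<forall>\<^sub>F t in nhds 0. c t \<in> config_space N) \<and>
     (\<forall>i\<in>{1..N}. \<forall>a<N - 1. (\<lambda>t. c t i $ a) differentiable (at 0))"

text \<open>
  A critical point of a function on the manifold \<open>config_space N\<close>: the derivative vanishes in every
  tangent direction, tangent vectors being the velocities of curves in the manifold.
  Lemma \<open>equilibrium_iff_equation\<close> below gives the explicit equations for the potential.
\<close>

definition critical_point :: "nat \<Rightarrow> ((nat \<Rightarrow> real vec) \<Rightarrow> real) \<Rightarrow> (nat \<Rightarrow> real vec) \<Rightarrow> bool" where
  "critical_point N V q \<longleftrightarrow> q \<in> config_space N \<and>
     (\<forall>c. config_curve N c q \<longrightarrow> ((\<lambda>t. V (c t)) has_real_derivative 0) (at 0))"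

definition equilibrium ::
  "nat \<Rightarrow> (nat \<Rightarrow> real) \<Rightarrow> (real \<Rightarrow> real) \<Rightarrow> (nat \<Rightarrow> real vec) \<Rightarrow> bool" where
  "equilibrium N m G q \<longleftrightarrow> critical_point N (potential N m G) q"

definition S_coeff :: "(real \<Rightarrow> real) \<Rightarrow> (nat \<Rightarrow> real vec) \<Rightarrow> nat \<Rightarrow> nat \<Rightarrow> real" where
  "S_coeff G q i j = deriv G (geo_dist (q i) (q j)) / sin (geo_dist (q i) (q j))"

definition config_mat :: "nat \<Rightarrow> (nat \<Rightarrow> real vec) \<Rightarrow> real mat" where
  "config_mat N q = mat_of_cols (N - 1) (map q [1..<N+1])"

definition config_mat_del :: "nat \<Rightarrow> (nat \<Rightarrow> real vec) \<Rightarrow> nat \<Rightarrow> real mat" where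
  "config_mat_del N q k = mat_of_cols (N - 1) (map q (filter (\<lambda>i. i \<noteq> k) [1..<N+1]))"

definition Delta :: "nat \<Rightarrow> (nat \<Rightarrow> real vec) \<Rightarrow> nat \<Rightarrow> real" where
  "Delta N q k = (-1) ^ (k + 1) * det (config_mat_del N q k)"

definition dziobek :: "nat \<Rightarrow> (nat \<Rightarrow> real vec) \<Rightarrow> bool" where
  "dziobek N q \<longleftrightarrow> vec_space.rank (N - 1) (config_mat N q) = N - 1"

definition force ::
  "nat \<Rightarrow> (nat \<Rightarrow> real) \<Rightarrow> (real \<Rightarrow> real) \<Rightarrow> (nat \<Rightarrow> real vec) \<Rightarrow> nat \<Rightarrow> real vec" where
  "force N m G q i = finsum_vec TYPE(real) (N - 1)
     (\<lambda>j. (m i * m j * deriv G (geo_dist (q i) (q j)) / sin (geo_dist (q i) (q j))) \<cdot>\<^sub>v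
        (q j - cos (geo_dist (q i) (q j)) \<cdot>\<^sub>v q i)) ({1..N} - {i})"

lemma cauchy_vec:
  fixes u v :: "real vec"
  assumes "u \<in> unit_sphere n" "v \<in> unit_sphere n"
  shows "\<bar>u \<bullet> v\<bar> \<le> 1"
proof -
  have d: "dim_vec u = n" "dim_vec v = n" and
    s: "(\<Sum>a=0..<n. u $ a * u $ a) = 1" "(\<Sum>a=0..<n. v $ a * v $ a) = 1"
    using assms by (auto simp: unit_sphere_def scalar_prod_def)
  have "(\<Sum>a=0..<n. (u $ a + v $ a)\<^sup>2) \<ge> 0" "(\<Sum>a=0..<n. (u $ a - v $ a)\<^sup>2) \<ge> 0"
    by (auto intro!: sum_nonneg)
  moreover have "(\<Sum>a=0..<n. (u $ a + v $ a)\<^sup>2) = (\<Sum>a=0..<n. u $ a * u $ a + v $ a * v $ a + 2 * (u $ a * v $ a))"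
    "(\<Sum>a=0..<n. (u $ a - v $ a)\<^sup>2) = (\<Sum>a=0..<n. u $ a * u $ a + v $ a * v $ a - 2 * (u $ a * v $ a))"
    by (auto intro!: sum.cong simp: power2_eq_square algebra_simps)
  ultimately show ?thesis
    using s d by (simp add: sum.distrib sum_subtractf sum_distrib_left[symmetric] scalar_prod_def)
qed

lemma config_inner:
  assumes "q \<in> config_space N" "i \<in> {1..N}" "j \<in> {1..N}" "i \<noteq> j"
  shows "-1 < q i \<bullet> q j" "q i \<bullet> q j < 1"
    "cos (geo_dist (q i) (q j)) = q i \<bullet> q j" "sin (geo_dist (q i) (q j)) > 0"
    "q i \<in> carrier_vec (N - 1)" "q i \<bullet> q i = 1"
proof -
  have u: "q i \<in> unit_sphere (N - 1)" "q j \<in> unit_sphere (N - 1)"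
    and d: "geo_dist (q i) (q j) \<in> {0<..<pi}"
    using assms by (auto simp: config_space_def)
  have b: "-1 \<le> q i \<bullet> q j" "q i \<bullet> q j \<le> 1"
    using cauchy_vec[OF u] by linarith+
  have "q i \<bullet> q j \<noteq> -1" "q i \<bullet> q j \<noteq> 1"
    using d by (auto simp: geo_dist_def)
  then show "-1 < q i \<bullet> q j" "q i \<bullet> q j < 1"
    using b by linarith+
  show "cos (geo_dist (q i) (q j)) = q i \<bullet> q j"
    using b by (simp add: geo_dist_def)
  show "sin (geo_dist (q i) (q j)) > 0"
    using d by (auto intro: sin_gt_zero)
  show "q i \<in> carrier_vec (N - 1)" "q i \<bullet> q i = 1"
    using u by (auto simp: unit_sphere_def)
qed

lemma sum_pairs:
  fixes f :: "nat \<Rightarrow> nat \<Rightarrow> real"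
  shows "(\<Sum>i=1..N. \<Sum>j=i+1..N. f i j + f j i) = (\<Sum>i=1..N. \<Sum>j\<in>{1..N} - {i}. f i j)"
proof (induction N)
  case (Suc N)
  have "(\<Sum>i=1..Suc N. \<Sum>j=i+1..Suc N. f i j + f j i)
      = (\<Sum>i=1..N. \<Sum>j=i+1..N. f i j + f j i) + (\<Sum>i=1..N. f i (Suc N) + f (Suc N) i)"
    by (simp add: sum.distrib)
  moreover have "(\<Sum>j\<in>{1..Suc N} - {i}. f i j) = (\<Sum>j\<in>{1..N} - {i}. f i j) + f i (Suc N)"
    if "i \<in> {1..N}" for i
  proof -
    have "{1..Suc N} - {i} = insert (Suc N) ({1..N} - {i})" using that by auto
    then show ?thesis by simp
  qed
  moreover have "{1..Suc N} - {Suc N} = {1..N}" by auto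
  ultimately show ?case
    using Suc by (simp add: sum.distrib)
qed simp

lemma force_carrier: "q \<in> config_space N \<Longrightarrow> i \<in> {1..N} \<Longrightarrow> force N m G q i \<in> carrier_vec (N - 1)"
  unfolding force_def config_space_def unit_sphere_def
  by (rule finsum_vec_closed) auto

lemma inner_force:
  assumes q: "q \<in> config_space N" and i: "i \<in> {1..N}" and v: "v \<in> carrier_vec (N - 1)"
  shows "v \<bullet> force N m G q i =
    (\<Sum>j\<in>{1..N} - {i}. m i * m j * S_coeff G q i j * (v \<bullet> q j - (q i \<bullet> q j) * (v \<bullet> q i)))"
proof -
  let ?n = "N - 1"
  have c: "q j \<in> carrier_vec ?n" if "j \<in> {1..N}" for j
    using that q by (auto simp: config_space_def unit_sphere_def)
  have "v \<bullet> force N m G q i = (\<Sum>a=0..<?n. v $ a * force N m G q i $ a)"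
    using carrier_vecD[OF force_carrier[OF q i, of m G]] by (simp add: scalar_prod_def)
  also have "\<dots> = (\<Sum>a=0..<?n. v $ a * (\<Sum>j\<in>{1..N} - {i}. m i * m j * S_coeff G q i j * (q j $ a - (q i \<bullet> q j) * q i $ a)))"
  proof (rule sum.cong[OF refl], goal_cases)
    case (1 a)
    have "force N m G q i $ a = (\<Sum>j\<in>{1..N} - {i}. m i * m j * S_coeff G q i j * (q j $ a - (q i \<bullet> q j) * q i $ a))"
      unfolding force_def
    proof (subst index_finsum_vec, goal_cases)
      case 4
      then show ?case
      proof (rule sum.cong[OF refl])
        fix j assume j: "j \<in> {1..N} - {i}"
        then show "((m i * m j * deriv G (geo_dist (q i) (q j)) / sin (geo_dist (q i) (q j))) \<cdot>\<^sub>v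
        (q j - cos (geo_dist (q i) (q j)) \<cdot>\<^sub>v q i)) $ a = m i * m j * S_coeff G q i j * (q j $ a - (q i \<bullet> q j) * q i $ a)"
          using c[of i] c[of j] i 1 config_inner(3)[OF q i, of j] by (auto simp: S_coeff_def)
      qed
    qed (use 1 c i in auto)
    then show ?case by simp
  qed
  also have "\<dots> = (\<Sum>j\<in>{1..N} - {i}. \<Sum>a=0..<?n. v $ a * (m i * m j * S_coeff G q i j * (q j $ a - (q i \<bullet> q j) * q i $ a)))"
    by (simp add: sum_distrib_left, rule sum.swap)
  also have "\<dots> = (\<Sum>j\<in>{1..N} - {i}. m i * m j * S_coeff G q i j * (v \<bullet> q j - (q i \<bullet> q j) * (v \<bullet> q i)))"
  proof (rule sum.cong[OF refl], goal_cases)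
    case (1 j)
    have vj: "v \<bullet> q j = (\<Sum>a=0..<?n. v $ a * q j $ a)" and vi: "v \<bullet> q i = (\<Sum>a=0..<?n. v $ a * q i $ a)"
      using c[of i] c[of j] i 1 by (auto simp: scalar_prod_def)
    show ?case unfolding vj vi sum_distrib_left sum_subtractf[symmetric]
      by (rule sum.cong) (auto simp: algebra_simps)
  qed
  finally show ?thesis .
qed

lemma potential_curve_deriv:
  assumes G: "smooth_on_0_pi G" and q: "q \<in> config_space N" and c: "config_curve N c q"
  defines "v \<equiv> \<lambda>i. vec (N - 1) (\<lambda>a. deriv (\<lambda>t. c t i $ a) 0)"
  shows "((\<lambda>t. potential N m G (c t)) has_real_derivative - (\<Sum>i=1..N. v i \<bullet> force N m G q i)) (at 0)"
    and "\<And>i. i \<in> {1..N} \<Longrightarrow> v i \<bullet> q i = 0"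
proof -
  let ?n = "N - 1"
  have c0: "c 0 = q" and ev: "\<forall>\<^sub>F t in nhds 0. c t \<in> config_space N"
    using c by (auto simp: config_curve_def)
  have qc: "q j \<in> carrier_vec ?n" if "j \<in> {1..N}" for j
    using that q by (auto simp: config_space_def unit_sphere_def)
  have dc: "((\<lambda>t. c t i $ a) has_real_derivative v i $ a) (at 0)" if "i \<in> {1..N}" "a < ?n" for i a
    using c that DERIV_deriv_iff_real_differentiable[of "\<lambda>t. c t i $ a" 0]
    by (auto simp: config_curve_def v_def)
  have dd: "((\<lambda>t. c t i \<bullet> c t j) has_real_derivative v i \<bullet> q j + v j \<bullet> q i) (at 0)"
    if ij: "i \<in> {1..N}" "j \<in> {1..N}" for i j
  proof -
    have "((\<lambda>t. \<Sum>a=0..<?n. c t i $ a * c t j $ a) has_real_derivative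
        (\<Sum>a=0..<?n. v i $ a * c 0 j $ a + v j $ a * c 0 i $ a)) (at 0)"
      by (rule DERIV_sum, rule DERIV_mult) (use dc ij in auto)
    moreover have "(\<Sum>a=0..<?n. v i $ a * c 0 j $ a + v j $ a * c 0 i $ a) = v i \<bullet> q j + v j \<bullet> q i"
      using qc[of i] qc[of j] ij by (auto simp: c0 scalar_prod_def sum.distrib)
    moreover have "\<forall>\<^sub>F t in nhds 0. c t i \<bullet> c t j = (\<Sum>a=0..<?n. c t i $ a * c t j $ a)"
    proof (use ev in eventually_elim)
      case (elim t)
      then have "dim_vec (c t j) = N - 1" using ij by (auto simp: config_space_def unit_sphere_def)
      then show ?case by (simp add: scalar_prod_def)
    qed
    ultimately show ?thesis
      by (simp only: DERIV_cong_ev[OF refl _ refl])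
  qed
  show vq: "v i \<bullet> q i = 0" if i: "i \<in> {1..N}" for i
  proof -
    have "((\<lambda>t. 1) has_real_derivative v i \<bullet> q i + v i \<bullet> q i) (at 0)"
    proof (rule iffD1[OF DERIV_cong_ev[OF refl _ refl] dd[OF i i]])
      show "\<forall>\<^sub>F t in nhds 0. c t i \<bullet> c t i = 1"
        using ev by eventually_elim (use i in \<open>auto simp: config_space_def unit_sphere_def\<close>)
    qed
    then show ?thesis using DERIV_unique[OF _ DERIV_const] by fastforce
  qed
  let ?f = "\<lambda>i j. - (m i * m j * S_coeff G q i j * (v i \<bullet> q j))"
  have sym: "q j \<bullet> q i = q i \<bullet> q j" if "i \<in> {1..N}" "j \<in> {1..N}" for i j
    using that qc[of i] qc[of j] by (metis comm_scalar_prod)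
  have "((\<lambda>t. m i * m j * G (geo_dist (c t i) (c t j))) has_real_derivative ?f i j + ?f j i) (at 0)"
    if ij: "i \<in> {1..N}" "j \<in> {1..N}" "i \<noteq> j" for i j
  proof -
    note ci = config_inner[OF q ij]
    have s: "sqrt (1 - (q i \<bullet> q j)\<^sup>2) = sin (geo_dist (q i) (q j))"
      using ci by (simp add: geo_dist_def sin_arccos)
    have "(arccos has_real_derivative inverse (- sqrt (1 - (c 0 i \<bullet> c 0 j)\<^sup>2))) (at (c 0 i \<bullet> c 0 j))"
      using ci by (intro DERIV_arccos) (auto simp: c0)
    note A = DERIV_chain2[OF this dd[OF ij(1,2)]]
    have "inverse (- sqrt (1 - (c 0 i \<bullet> c 0 j)\<^sup>2)) * (v i \<bullet> q j + v j \<bullet> q i)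
       = - (v i \<bullet> q j + v j \<bullet> q i) / sin (geo_dist (q i) (q j))"
      unfolding c0 s by (simp add: divide_inverse algebra_simps)
    with A have 1: "((\<lambda>t. geo_dist (c t i) (c t j)) has_real_derivative
       - (v i \<bullet> q j + v j \<bullet> q i) / sin (geo_dist (q i) (q j))) (at 0)"
      by (simp only: geo_dist_def)
    have "geo_dist (q i) (q j) \<in> {0<..<pi}"
      using q ij by (auto simp: config_space_def)
    moreover have "\<forall>x\<in>{0<..<pi}. (deriv ^^ 0) G differentiable (at x)"
      using G unfolding smooth_on_0_pi_def by blast
    ultimately have "(G has_real_derivative deriv G (geo_dist (c 0 i) (c 0 j))) (at (geo_dist (c 0 i) (c 0 j)))"
      by (simp add: c0 DERIV_deriv_iff_real_differentiable)
    from DERIV_cmult[OF DERIV_chain2[OF this 1], of "m i * m j"]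
    show ?thesis
    proof (rule back_subst[of "\<lambda>D. (_ has_real_derivative D) (at 0)"])
      have "geo_dist (q j) (q i) = geo_dist (q i) (q j)" using sym[OF ij(1,2)] by (simp add: geo_dist_def)
      then show "m i * m j * (deriv G (geo_dist (c 0 i) (c 0 j)) * (- (v i \<bullet> q j + v j \<bullet> q i) / sin (geo_dist (q i) (q j))))
        = ?f i j + ?f j i"
        using ci(4) by (simp add: c0 S_coeff_def field_simps)
    qed
  qed
  then have "((\<lambda>t. potential N m G (c t)) has_real_derivative (\<Sum>i=1..N. \<Sum>j=i+1..N. ?f i j + ?f j i)) (at 0)"
    unfolding potential_def by (intro DERIV_sum) auto
  moreover have "(\<Sum>i=1..N. \<Sum>j=i+1..N. ?f i j + ?f j i) = - (\<Sum>i=1..N. v i \<bullet> force N m G q i)"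
    unfolding sum_pairs sum_negf[symmetric]
  proof (rule sum.cong[OF refl], goal_cases)
    case (1 i)
    have "v i \<in> carrier_vec ?n" by (simp add: v_def)
    from inner_force[OF q 1 this] show ?case by (simp add: vq[OF 1] sum_negf)
  qed
  ultimately show "((\<lambda>t. potential N m G (c t)) has_real_derivative - (\<Sum>i=1..N. v i \<bullet> force N m G q i)) (at 0)"
    by simp
qed

lemma great_circle_curve:
  assumes q: "q \<in> config_space N" and i: "i \<in> {1..N}"
    and u: "u \<in> carrier_vec (N - 1)" "u \<bullet> u = 1" "u \<bullet> q i = 0"
  shows "config_curve N (\<lambda>t. q(i := cos (r * t) \<cdot>\<^sub>v q i + sin (r * t) \<cdot>\<^sub>v u)) q"
    (is "config_curve N ?c q")
proof -
  let ?n = "N - 1"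
  have qc: "q j \<in> carrier_vec ?n" and qq: "q j \<bullet> q j = 1" if "j \<in> {1..N}" for j
    using that q by (auto simp: config_space_def unit_sphere_def)
  let ?w = "\<lambda>t. cos (r * t) \<cdot>\<^sub>v q i + sin (r * t) \<cdot>\<^sub>v u"
  have wc: "?w t \<in> carrier_vec ?n" for t using qc[OF i] u by simp
  have wx: "?w t \<bullet> x = cos (r * t) * (q i \<bullet> x) + sin (r * t) * (u \<bullet> x)" if "x \<in> carrier_vec ?n" for t x
    using that qc[OF i] u by (simp add: add_scalar_prod_distrib[of _ ?n])
  have qu: "q i \<bullet> u = 0" using u qc[OF i] by (metis comm_scalar_prod)
  have ww: "?w t \<bullet> ?w t = 1" for t
  proof -
    have "q i \<bullet> ?w t = cos (r * t)" "u \<bullet> ?w t = sin (r * t)"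
      using u qu qq[OF i] qc[OF i] by (simp_all add: scalar_prod_add_distrib[of _ ?n])
    then show ?thesis using wx[OF wc] by (simp add: power2_eq_square[symmetric])
  qed
  have g: "geo_dist (q j) (?w t) = geo_dist (?w t) (q j)" if "j \<in> {1..N}" for t j
    using comm_scalar_prod[OF qc[OF that] wc] by (simp add: geo_dist_def)
  have "\<forall>\<^sub>F t in nhds 0. \<forall>j\<in>{1..N} - {i}. geo_dist (?w t) (q j) \<in> {0<..<pi}"
  proof (rule eventually_ball_finite, simp, rule ballI)
    fix j assume j: "j \<in> {1..N} - {i}"
    then have jj: "j \<in> {1..N}" "i \<noteq> j" by auto
    have "isCont (\<lambda>t. ?w t \<bullet> q j) 0"
      unfolding wx[OF qc[OF jj(1)]] by (intro continuous_intros)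
    then have "((\<lambda>t. ?w t \<bullet> q j) \<longlongrightarrow> ?w 0 \<bullet> q j) (nhds 0)"
      unfolding isCont_def using tendsto_at_iff_tendsto_nhds[of "\<lambda>t. ?w t \<bullet> q j" 0] by (rule iffD1[rotated])
    moreover have "?w 0 \<bullet> q j = q i \<bullet> q j" unfolding wx[OF qc[OF jj(1)]] by simp
    ultimately have T: "((\<lambda>t. ?w t \<bullet> q j) \<longlongrightarrow> q i \<bullet> q j) (nhds 0)" by (simp only:)
    have "\<forall>\<^sub>F t in nhds 0. -1 < ?w t \<bullet> q j" "\<forall>\<^sub>F t in nhds 0. ?w t \<bullet> q j < 1"
      using order_tendstoD[OF T] config_inner(1,2)[OF q i jj] by blast+
    then show "\<forall>\<^sub>F t in nhds 0. geo_dist (?w t) (q j) \<in> {0<..<pi}"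
    proof eventually_elim
      case (elim t)
      then show ?case using arccos_lt_bounded[of "?w t \<bullet> q j"] by (simp add: geo_dist_def)
    qed
  qed
  then have "\<forall>\<^sub>F t in nhds 0. ?c t \<in> config_space N"
  proof eventually_elim
    case (elim t)
    show ?case unfolding config_space_def mem_Collect_eq
    proof (intro conjI ballI impI)
      fix j assume j: "j \<in> {1..N}"
      show "?c t j \<in> unit_sphere (N - 1)"
        using wc ww qc[OF j] qq[OF j] by (auto simp: unit_sphere_def)
      fix k assume k: "k \<in> {1..N}" "j \<noteq> k"
      show "geo_dist (?c t j) (?c t k) \<in> {0<..<pi}"
      proof (cases "j = i \<or> k = i")
        case True
        then show ?thesis using elim j k g by fastforce
      next
        case False
        then show ?thesis using q j k by (auto simp: config_space_def)
      qed
    qed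
  qed
  moreover have "?c 0 = q"
    using qc[OF i] u by (intro ext) auto
  moreover have "(\<lambda>t. ?c t j $ a) differentiable (at 0)" if "j \<in> {1..N}" "a < N - 1" for j a
  proof (cases "j = i")
    case True
    have "(\<lambda>t. cos (r * t) * q i $ a + sin (r * t) * u $ a) differentiable (at 0)"
      unfolding real_differentiable_def by (rule exI) (rule derivative_eq_intros refl)+
    then show ?thesis using True that qc[OF i] u by simp
  qed simp
  ultimately show ?thesis by (simp add: config_curve_def)
qed

lemma equilibrium_iff_equation:
  assumes G: "smooth_on_0_pi G" and q: "q \<in> config_space N"
  shows "equilibrium N m G q \<longleftrightarrow> (\<forall>i\<in>{1..N}. force N m G q i = 0\<^sub>v (N - 1))"
proof
  assume F: "\<forall>i\<in>{1..N}. force N m G q i = 0\<^sub>v (N - 1)"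
  show "equilibrium N m G q"
    unfolding equilibrium_def critical_point_def
  proof (intro conjI allI impI q)
    fix c assume "config_curve N c q"
    from potential_curve_deriv(1)[OF G q this, of m] F
    show "((\<lambda>t. potential N m G (c t)) has_real_derivative 0) (at 0)"
      by simp
  qed
next
  assume eq: "equilibrium N m G q"
  show "\<forall>i\<in>{1..N}. force N m G q i = 0\<^sub>v (N - 1)"
  proof (rule ballI, rule ccontr)
    fix i assume i: "i \<in> {1..N}" and ne: "force N m G q i \<noteq> 0\<^sub>v (N - 1)"
    let ?n = "N - 1" and ?F = "force N m G q i"
    have Fc: "?F \<in> carrier_vec ?n" by (rule force_carrier[OF q i])
    have qc: "q i \<in> carrier_vec ?n" "q i \<bullet> q i = 1"
      using q i by (auto simp: config_space_def unit_sphere_def)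
    have qF: "q i \<bullet> ?F = 0"
      unfolding inner_force[OF q i qc(1)] using qc(2) by simp
    then have Fq: "?F \<bullet> q i = 0" using Fc qc by (metis comm_scalar_prod)
    have "?F \<bullet> ?F > 0"
    proof -
      obtain a where a: "a < ?n" "?F $ a \<noteq> 0"
        using ne Fc by (metis carrier_vecD eq_vecI index_zero_vec(1) index_zero_vec(2))
      then have "(\<Sum>a=0..<?n. ?F $ a * ?F $ a) > 0"
        by (intro sum_pos2[of _ a]) (auto simp: zero_less_mult_iff linorder_neq_iff)
      then show ?thesis using Fc by (auto simp: scalar_prod_def)
    qed
    define r where "r = sqrt (?F \<bullet> ?F)"
    have r: "r > 0" "r * r = ?F \<bullet> ?F" using \<open>?F \<bullet> ?F > 0\<close> by (auto simp: r_def)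
    define u where "u = (1 / r) \<cdot>\<^sub>v ?F"
    have u: "u \<in> carrier_vec ?n" "u \<bullet> u = 1" "u \<bullet> q i = 0"
      using Fc qc r Fq by (auto simp: u_def field_simps)
    define c where "c = (\<lambda>t. q(i := cos (r * t) \<cdot>\<^sub>v q i + sin (r * t) \<cdot>\<^sub>v u))"
    have cc: "config_curve N c q" unfolding c_def by (rule great_circle_curve[OF q i u])
    let ?v = "\<lambda>j. vec ?n (\<lambda>a. deriv (\<lambda>t. c t j $ a) 0)"
    have v: "?v j = (if j = i then ?F else 0\<^sub>v ?n)" if j: "j \<in> {1..N}" for j
    proof (rule eq_vecI)
      fix a assume "a < dim_vec (if j = i then ?F else 0\<^sub>v ?n)"
      then have a: "a < ?n" using Fc by (auto split: if_splits)
      have "((\<lambda>t. cos (r * t) * q i $ a + sin (r * t) * u $ a) has_real_derivative r * u $ a) (at 0)"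
        by (rule derivative_eq_intros refl | simp)+
      moreover have "(\<lambda>t. c t i $ a) = (\<lambda>t. cos (r * t) * q i $ a + sin (r * t) * u $ a)"
        using a qc u by (auto simp: c_def)
      moreover have "r * u $ a = ?F $ a" using a Fc r by (simp add: u_def)
      ultimately have "deriv (\<lambda>t. c t i $ a) 0 = ?F $ a" by (metis DERIV_imp_deriv)
      moreover have "deriv (\<lambda>t. c t j $ a) 0 = 0" if "j \<noteq> i"
        using that by (simp add: c_def)
      ultimately show "?v j $ a = (if j = i then ?F else 0\<^sub>v ?n) $ a" using a by simp
    qed (use Fc in auto)
    have "((\<lambda>t. potential N m G (c t)) has_real_derivative 0) (at 0)"
      using eq cc by (auto simp: equilibrium_def critical_point_def)
    from DERIV_unique[OF potential_curve_deriv(1)[OF G q cc] this]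
    have "(\<Sum>j=1..N. ?v j \<bullet> force N m G q j) = 0" by simp
    moreover have "(\<Sum>j=1..N. ?v j \<bullet> force N m G q j) = (\<Sum>j=1..N. if j = i then ?F \<bullet> ?F else 0)"
      using v force_carrier[OF q] by (intro sum.cong) auto
    ultimately show False using i \<open>?F \<bullet> ?F > 0\<close> by simp
  qed
qed

end

theory Submission
  imports Defs
begin

text \<open>
  By Laplace expansion the vector of the \<open>\<Delta>\<^sub>k\<close> lies in the kernel of \<open>X\<close>, and by the rank
  condition it spans it.  Each equation of equilibrium is a linear relation among the bodies whose
  \<open>j\<close>-th coefficient is \<open>m\<^sub>i m\<^sub>j S\<^sub>i\<^sub>j\<close> for \<open>j \<noteq> i\<close>, so equilibrium forces these coefficients to be
  proportional to \<open>\<Delta>\<^sub>j\<close>.  By the symmetry of \<open>S\<close> this means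
  \<open>m\<^sub>i m\<^sub>j S\<^sub>i\<^sub>j = \<kappa> \<Delta>\<^sub>i \<Delta>\<^sub>j\<close> for a constant \<open>\<kappa>\<close>, and conversely this makes the force on body \<open>i\<close> a
  multiple of \<open>q\<^sub>i\<close>, hence zero, as it is tangent.  The system of the theorem says the same with
  \<open>\<kappa>\<close> eliminated.
\<close>

section \<open>Linear relations among the bodies and the minors of \<open>X\<close>\<close>

lemma config_mat_del_carrier:
  assumes "k \<in> {1..N}"
  shows "config_mat_del N q k \<in> carrier_mat (N - 1) (N - 1)"
proof -
  have "length (filter (\<lambda>i. i \<noteq> k) [1..<N+1]) = card ({1..N} - {k})"
    by (subst distinct_card[symmetric]) (auto intro!: arg_cong[of _ _ card])
  also have "\<dots> = N - 1" using assms by simp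
  finally show ?thesis by (simp add: config_mat_del_def carrier_matI del: upt_Suc)
qed

text \<open>Bridge between two ways to delete a column: dropping a label from a list that starts at
  1, and skipping an index counted from 0 as \<open>mat_delete\<close> does.\<close>

lemma nth_filter_neq_upt:
  assumes "j < N" "c < N - 1"
  shows "filter (\<lambda>i. i \<noteq> Suc j) [1..<N+1] ! c = Suc (insert_index j c)"
proof -
  have "[1..<N+1] = [1..<Suc j] @ Suc j # [j+2..<N+1]"
    using assms upt_add_eq_append[of 1 "Suc j" "N - j"]
    by (simp add: upt_conv_Cons del: upt_Suc)
  then have "filter (\<lambda>i. i \<noteq> Suc j) [1..<N+1] = [1..<Suc j] @ [j+2..<N+1]"
    by (auto simp: filter_id_conv simp del: upt_Suc)
  then show ?thesis
    using assms by (cases "c < j") (auto simp: nth_append simp del: upt_Suc)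
qed

text \<open>A square matrix made of \<open>X\<close> and a second copy of its row \<open>a\<close>
  is singular, and Laplace expansion along the added row is exactly this sum.\<close>

lemma Delta_relation:
  assumes "a < N - 1"
  shows "(\<Sum>k=1..N. Delta N q k * q k $ a) = 0"
proof -
  \<comment> \<open>the configuration matrix with its row \<open>a\<close> repeated on top\<close>
  define M where "M = mat N N (\<lambda>(i, j). if i = 0 then q (Suc j) $ a else q (Suc j) $ (i - 1))"
  have M: "M \<in> carrier_mat N N" by (simp add: M_def)
  have "row M 0 = row M (Suc a)"
    using assms by (intro eq_vecI) (auto simp: M_def)
  then have "det M = 0"
    using det_identical_rows[OF M, of 0 "Suc a"] assms by auto
  moreover have "det M = (\<Sum>j<N. M $$ (0, j) * cofactor M 0 j)"
    using laplace_expansion_row[OF M, of 0] assms by simp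
  moreover have "M $$ (0, j) * cofactor M 0 j = Delta N q (Suc j) * q (Suc j) $ a" if "j < N" for j
  proof -
    have "mat_delete M 0 j = config_mat_del N q (Suc j)"
    proof (rule eq_matI)
      fix r c assume "r < dim_row (config_mat_del N q (Suc j))" "c < dim_col (config_mat_del N q (Suc j))"
      then have rc: "r < N - 1" "c < N - 1"
        using config_mat_del_carrier[of "Suc j" N q] that by auto
      have *: "filter (\<lambda>i. i \<noteq> Suc j) [Suc 0..<Suc N] ! c = Suc (insert_index j c)"
        using nth_filter_neq_upt[OF that rc(2)] by simp
      have l: "length (filter (\<lambda>i. i \<noteq> Suc j) [Suc 0..<Suc N]) = N - 1"
        using config_mat_del_carrier[of "Suc j" N q] that by (auto simp: config_mat_del_def)
      show "mat_delete M 0 j $$ (r, c) = config_mat_del N q (Suc j) $$ (r, c)"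
        using rc that l unfolding config_mat_del_def
        by (simp add: mat_of_cols_index * mat_delete_def M_def insert_index_def del: upt_Suc)
    qed (use config_mat_del_carrier[of "Suc j" N q] that M in auto)
    \<comment> \<open>Column \<open>j\<close>, counted from 0, belongs to body \<open>Suc j\<close>,
      and the signs \<open>(-1)^(0 + j)\<close> and \<open>(-1)^(Suc j + 1)\<close> agree.\<close>
    then show ?thesis
      using that by (simp add: cofactor_def Delta_def M_def)
  qed
  ultimately have "(\<Sum>j<N. Delta N q (Suc j) * q (Suc j) $ a) = 0" by simp
  then show ?thesis
    by (simp add: sum.atLeast1_atMost_eq)
qed

text \<open>Since \<open>y k = 0\<close>, the relation involves only the columns of the matrix
  without body \<open>k\<close>, and these are independent because its determinant is
  \<open>Delta N q k\<close> up to sign.\<close>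

lemma relation_zero:
  assumes k: "k \<in> {1..N}" "Delta N q k \<noteq> 0" and y: "y k = 0"
    and rel: "\<And>a. a < N - 1 \<Longrightarrow> (\<Sum>j=1..N. y j * q j $ a) = 0"
    and i: "i \<in> {1..N}"
  shows "y i = 0"
proof (cases "i = k")
  case False
  let ?n = "N - 1"
  let ?L = "filter (\<lambda>i. i \<noteq> k) [1..<N+1]"
  have l: "length ?L = ?n" and A: "config_mat_del N q k \<in> carrier_mat ?n ?n"
    using config_mat_del_carrier[OF k(1), of q] by (auto simp: config_mat_del_def)
  let ?v = "vec ?n (\<lambda>c. y (?L ! c))"
  have "config_mat_del N q k *\<^sub>v ?v = 0\<^sub>v ?n"
  proof (rule eq_vecI)
    fix a assume "a < dim_vec (0\<^sub>v ?n)"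
    then have a: "a < ?n" by simp
    have "(config_mat_del N q k *\<^sub>v ?v) $ a = (\<Sum>c = 0..<?n. y (?L ! c) * q (?L ! c) $ a)"
      using a l A by (auto simp: config_mat_del_def scalar_prod_def mat_of_cols_index mult.commute
        simp del: upt_Suc intro!: sum.cong)
    \<comment> \<open>The sum over positions in \<open>?L\<close> becomes a sum over labels, to
      which the vanishing term of body \<open>k\<close> is added.\<close>
    also have "\<dots> = sum_list (map (\<lambda>j. y j * q j $ a) ?L)"
      unfolding sum_list_sum_nth using l by (intro sum.cong) (auto simp del: upt_Suc)
    also have "\<dots> = (\<Sum>j\<in>{1..N} - {k}. y j * q j $ a)"
      by (subst sum_list_distinct_conv_sum_set) (auto intro!: sum.cong simp del: upt_Suc)
    also have "\<dots> = (\<Sum>j=1..N. y j * q j $ a)"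
      using y k by (simp add: sum.remove[of _ k])
    finally show "(config_mat_del N q k *\<^sub>v ?v) $ a = 0\<^sub>v ?n $ a" using rel a by simp
  qed (use A in auto)
  moreover have "det (config_mat_del N q k) \<noteq> 0" using k by (simp add: Delta_def)
  ultimately have v: "?v = 0\<^sub>v ?n"
    using det_0_iff_vec_prod_zero_field[OF A] vec_carrier[of ?n] by blast
  have "i \<in> set ?L" using i False by auto
  then obtain c where "c < ?n" "?L ! c = i" using l by (metis in_set_conv_nth)
  then show ?thesis using v by (metis index_vec index_zero_vec(1))
qed (use y in simp)

text \<open>Subtracting the multiple of \<open>Delta\<close> that agrees with \<open>y\<close> at
  \<open>k\<close> leaves a relation that vanishes at \<open>k\<close>, hence everywhere: the kernel
  of \<open>X\<close> is a line.\<close>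

lemma relation_proportional:
  assumes k: "k \<in> {1..N}" "Delta N q k \<noteq> 0"
    and rel: "\<And>a. a < N - 1 \<Longrightarrow> (\<Sum>j=1..N. y j * q j $ a) = 0"
  shows "\<exists>l. \<forall>i\<in>{1..N}. y i = l * Delta N q i"
proof (intro exI ballI)
  fix i assume i: "i \<in> {1..N}"
  let ?l = "y k / Delta N q k"
  have "(\<Sum>j=1..N. (y j - ?l * Delta N q j) * q j $ a) = 0" if a: "a < N - 1" for a
  proof -
    have "(\<Sum>j=1..N. (y j - ?l * Delta N q j) * q j $ a)
        = (\<Sum>j=1..N. y j * q j $ a) - ?l * (\<Sum>j=1..N. Delta N q j * q j $ a)"
      by (simp add: sum_distrib_left sum_subtractf[symmetric] left_diff_distrib mult.assoc)
    then show ?thesis using rel[OF a] Delta_relation[OF a] by simp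
  qed
  from relation_zero[OF k _ this i] k show "y i = ?l * Delta N q i" by simp
qed

text \<open>Full rank yields \<open>N - 1\<close> independent columns. They leave out some body
  \<open>k\<close>, and deleting that body keeps the rank.\<close>

lemma dziobek_Delta_nonzero:
  assumes "1 \<le> N" "dziobek N q" "\<And>i. i \<in> {1..N} \<Longrightarrow> q i \<in> carrier_vec (N - 1)"
  shows "\<exists>k\<in>{1..N}. Delta N q k \<noteq> 0"
proof -
  let ?n = "N - 1"
  interpret vec_space "TYPE(real)" ?n .
  have X: "config_mat N q \<in> carrier_mat ?n N"
    by (simp add: config_mat_def carrier_matI del: upt_Suc)
  have colsX: "set (cols (config_mat N q)) = q ` {1..N}"
    using assms(3) unfolding config_mat_def by (subst cols_mat_of_cols) auto
  \<comment> \<open>The rank is the size of a maximal independent set of columns.\<close>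
  let ?P = "\<lambda>T. T \<subseteq> set (cols (config_mat N q)) \<and> lin_indpt T"
  have "lin_indpt {}" by (rule finite_lin_indpt2) auto
  then have "?P {}" by blast
  with maximal_exists_superset[of "set (cols (config_mat N q))" ?P "{}"]
  obtain B where B: "maximal B ?P" by blast
  then have BX: "B \<subseteq> q ` {1..N}" "lin_indpt B" unfolding maximal_def colsX by auto
  have cB: "card B = ?n"
    using rank_card_indpt[OF X B] assms(2) by (simp add: dziobek_def)
  \<comment> \<open>Injectivity of \<open>q\<close> is not among the hypotheses, so one label is
    chosen for each vector of \<open>B\<close>; this gives \<open>N - 1\<close> labels out of
    \<open>N\<close>.\<close>
  obtain I where I: "I \<subseteq> {1..N}" "inj_on q I" "B = q ` I"
    using BX(1) unfolding subset_image_inj by blast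
  have "I \<noteq> {1..N}" using cB I assms(1) by (auto simp: card_image)
  then obtain k where k: "k \<in> {1..N}" "k \<notin> I" using I by blast
  have A: "config_mat_del N q k \<in> carrier_mat ?n ?n" by (rule config_mat_del_carrier[OF k(1)])
  have "set (cols (config_mat_del N q k)) = q ` ({1..N} - {k})"
    using assms(3) unfolding config_mat_del_def by (subst cols_mat_of_cols) auto
  then have "B \<subseteq> set (cols (config_mat_del N q k))" using I k by auto
  then have "rank (config_mat_del N q k) = ?n"
    using rank_ge_card_indpt[OF A _ BX(2)] rank_le_nc[OF A] cB by simp
  then show ?thesis
    using det_rank_iff[OF A] k by (auto simp: Delta_def)
qed

section \<open>Vanishing forces and the product form of the weights\<close>

lemma S_coeff_commute:
  assumes "q \<in> config_space N" "i \<in> {1..N}" "j \<in> {1..N}"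
  shows "S_coeff G q j i = S_coeff G q i j"
proof -
  have "q j \<bullet> q i = q i \<bullet> q j"
    using assms by (intro comm_scalar_prod) (auto simp: config_space_def unit_sphere_def)
  then show ?thesis by (simp add: S_coeff_def geo_dist_def)
qed

text \<open>The sign condition on the derivative of \<open>G\<close> enters here: it excludes zeros
  of the numerator.\<close>

lemma S_coeff_nonzero:
  assumes "attractive G \<or> repulsive G" "q \<in> config_space N" "i \<in> {1..N}" "j \<in> {1..N}" "i \<noteq> j"
  shows "S_coeff G q i j \<noteq> 0"
proof -
  have "geo_dist (q i) (q j) \<in> {0<..<pi}" using assms by (auto simp: config_space_def)
  then have "deriv G (geo_dist (q i) (q j)) \<noteq> 0"
    using assms(1) unfolding attractive_def repulsive_def by (metis less_irrefl)
  then show ?thesis using config_inner(4)[OF assms(2-5)] by (simp add: S_coeff_def)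
qed

text \<open>Pairing the force with a unit vector turns \<open>inner_force\<close> into coordinates,
  the form in which linear relations are handled above.\<close>

lemma index_force:
  assumes q: "q \<in> config_space N" and i: "i \<in> {1..N}" and a: "a < N - 1"
  shows "force N m G q i $ a =
    (\<Sum>j\<in>{1..N} - {i}. m i * m j * S_coeff G q i j * (q j $ a - (q i \<bullet> q j) * q i $ a))"
proof -
  have c: "q j \<in> carrier_vec (N - 1)" if "j \<in> {1..N}" for j
    using that q by (auto simp: config_space_def unit_sphere_def)
  have "force N m G q i $ a = unit_vec (N - 1) a \<bullet> force N m G q i"
    using force_carrier[OF q i] a by (simp add: scalar_prod_left_unit)
  also have "\<dots> = (\<Sum>j\<in>{1..N} - {i}. m i * m j * S_coeff G q i j * (q j $ a - (q i \<bullet> q j) * q i $ a))"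
    unfolding inner_force[OF q i unit_vec_carrier]
    using c i a by (intro sum.cong) (auto simp: scalar_prod_left_unit)
  finally show ?thesis .
qed

lemma force_zero_proportional:
  assumes q: "q \<in> config_space N" and i: "i \<in> {1..N}"
    and k: "k \<in> {1..N}" "Delta N q k \<noteq> 0" and F: "force N m G q i = 0\<^sub>v (N - 1)"
  shows "\<exists>l. \<forall>j\<in>{1..N} - {i}. m i * m j * S_coeff G q i j = l * Delta N q j"
proof -
  let ?w = "\<lambda>j. m i * m j * S_coeff G q i j"
  \<comment> \<open>\<open>?y i\<close> collects the multiples of \<open>q i\<close> that the
    tangential projections subtract, so the combination of all bodies with coefficients
    \<open>?y\<close> is the force itself.\<close>
  let ?y = "\<lambda>j. if j = i then - (\<Sum>l\<in>{1..N} - {i}. ?w l * (q i \<bullet> q l)) else ?w j"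
  have "(\<Sum>j=1..N. ?y j * q j $ a) = 0" if a: "a < N - 1" for a
  proof -
    have "(\<Sum>j=1..N. ?y j * q j $ a) = ?y i * q i $ a + (\<Sum>j\<in>{1..N} - {i}. ?w j * q j $ a)"
      using i by (simp add: sum.remove[of _ i])
    also have "\<dots> = force N m G q i $ a"
      unfolding index_force[OF q i a]
      by (simp add: sum_distrib_right right_diff_distrib sum_subtractf mult.assoc)
    finally show ?thesis using F a by simp
  qed
  from relation_proportional[OF k, of ?y, OF this] obtain l
    where l: "\<forall>j\<in>{1..N}. ?y j = l * Delta N q j" by blast
  have "?w j = l * Delta N q j" if "j \<in> {1..N} - {i}" for j
    using bspec[OF l, of j] that by simp
  then show ?thesis by blast
qed

text \<open>The kernel relation replaces the sum of \<open>Delta N q j\<close> times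
  \<open>q j\<close> over the other bodies by \<open>- Delta N q i\<close> times \<open>q i\<close>.
  The tangential correction is the same vector, so the two cancel.\<close>

lemma force_zero_of_product_form:
  assumes q: "q \<in> config_space N" and i: "i \<in> {1..N}"
    and w: "\<And>j. j \<in> {1..N} - {i} \<Longrightarrow> m i * m j * S_coeff G q i j = K * Delta N q i * Delta N q j"
  shows "force N m G q i = 0\<^sub>v (N - 1)"
proof -
  let ?n = "N - 1" and ?D = "Delta N q"
  have c: "q j \<in> carrier_vec ?n" if "j \<in> {1..N}" for j
    using that q by (auto simp: config_space_def unit_sphere_def)
  have qq: "q i \<bullet> q i = 1" using q i by (auto simp: config_space_def unit_sphere_def)
  have rest: "(\<Sum>j\<in>{1..N} - {i}. ?D j * q j $ a) = - (?D i * q i $ a)" if "a < ?n" for a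
    using Delta_relation[OF that, of q] i by (simp add: sum.remove[of _ i])
  \<comment> \<open>This is the kernel relation paired with the unit vector
    \<open>q i\<close>.\<close>
  have "(\<Sum>j\<in>{1..N} - {i}. ?D j * (q i \<bullet> q j))
      = (\<Sum>j\<in>{1..N} - {i}. \<Sum>a=0..<?n. q i $ a * (?D j * q j $ a))"
    using carrier_vecD[OF c]
    by (intro sum.cong) (auto simp: scalar_prod_def sum_distrib_left mult.left_commute)
  also have "\<dots> = (\<Sum>a=0..<?n. q i $ a * (\<Sum>j\<in>{1..N} - {i}. ?D j * q j $ a))"
    by (subst sum.swap) (simp add: sum_distrib_left)
  also have "\<dots> = (\<Sum>a=0..<?n. q i $ a * - (?D i * q i $ a))"
    by (intro sum.cong refl) (subst rest, auto)
  also have "\<dots> = - ?D i * (\<Sum>a=0..<?n. q i $ a * q i $ a)"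
    unfolding sum_distrib_left by (intro sum.cong) auto
  also have "\<dots> = - ?D i"
    using qq carrier_vecD[OF c[OF i]] by (simp add: scalar_prod_def)
  finally have C: "(\<Sum>j\<in>{1..N} - {i}. ?D j * (q i \<bullet> q j)) = - ?D i" .
  show ?thesis
  proof (rule eq_vecI)
    fix a assume "a < dim_vec (0\<^sub>v ?n)"
    then have a: "a < ?n" by simp
    have "force N m G q i $ a
        = (\<Sum>j\<in>{1..N} - {i}. K * ?D i * ?D j * (q j $ a - (q i \<bullet> q j) * q i $ a))"
      unfolding index_force[OF q i a] using w by (intro sum.cong) auto
    also have "\<dots> = K * ?D i * ((\<Sum>j\<in>{1..N} - {i}. ?D j * q j $ a)
        - (\<Sum>j\<in>{1..N} - {i}. ?D j * (q i \<bullet> q j)) * q i $ a)"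
      by (simp add: sum_distrib_left sum_distrib_right sum_subtractf[symmetric] algebra_simps)
    also have "\<dots> = 0" by (simp only: C rest[OF a]) simp
    finally show "force N m G q i $ a = 0\<^sub>v ?n $ a" using a by simp
  qed (use force_carrier[OF q i] in auto)
qed

text \<open>Each body \<open>i\<close> has its own factor \<open>l i\<close> of proportionality to
  \<open>Delta\<close>; symmetry of the weights makes \<open>l\<close> itself proportional to
  \<open>Delta\<close>.\<close>

lemma equilibrium_iff_product_form:
  assumes N: "N \<ge> 2" and m: "\<forall>i\<in>{1..N}. m i > 0" and G: "smooth_on_0_pi G"
    and sgn: "attractive G \<or> repulsive G" and q: "q \<in> config_space N" and dz: "dziobek N q"
  shows "equilibrium N m G q \<longleftrightarrow>
    (\<exists>K. \<forall>i\<in>{1..N}. \<forall>j\<in>{1..N} - {i}. m i * m j * S_coeff G q i j = K * Delta N q i * Delta N q j)"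
    (is "_ \<longleftrightarrow> ?R")
  unfolding equilibrium_iff_equation[OF G q]
proof
  assume ?R
  then show "\<forall>i\<in>{1..N}. force N m G q i = 0\<^sub>v (N - 1)"
    using force_zero_of_product_form[OF q] by blast
next
  assume F: "\<forall>i\<in>{1..N}. force N m G q i = 0\<^sub>v (N - 1)"
  let ?S = "S_coeff G q" and ?D = "Delta N q"
  obtain k where k: "k \<in> {1..N}" "?D k \<noteq> 0"
    using dziobek_Delta_nonzero[OF _ dz] q N by (auto simp: config_space_def unit_sphere_def)
  have "\<forall>i\<in>{1..N}. \<exists>l. \<forall>j\<in>{1..N} - {i}. m i * m j * ?S i j = l * ?D j"
    using force_zero_proportional[OF q _ k] F by blast
  then obtain l where l: "\<And>i j. i \<in> {1..N} \<Longrightarrow> j \<in> {1..N} - {i} \<Longrightarrow> m i * m j * ?S i j = l i * ?D j"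
    by metis
  \<comment> \<open>The rank condition makes one minor nonzero. At equilibrium all are, since the
    nonzero weight of \<open>j\<close> against another body \<open>i\<close> equals
    \<open>l i * ?D j\<close>.\<close>
  have D: "?D j \<noteq> 0" if j: "j \<in> {1..N}" for j
  proof -
    obtain i where "i \<in> {1..N}" "i \<noteq> j"
      by (rule that[of "if j = 1 then 2 else 1"]) (use N in auto)
    with l[of i j] S_coeff_nonzero[OF sgn q, of i j] bspec[OF m, of i] bspec[OF m, of j] j
    show ?thesis by auto
  qed
  have one: "1 \<in> {1..N}" using N by simp
  \<comment> \<open>The weight between bodies \<open>i\<close> and 1, computed from either side,
    relates \<open>l i\<close> to \<open>l 1\<close>.\<close>
  have K: "l i = l 1 / ?D 1 * ?D i" if i: "i \<in> {1..N}" for i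
  proof (cases "i = 1")
    case False
    then have "l i * ?D 1 = l 1 * ?D i"
      using l[of i 1] l[of 1 i] S_coeff_commute[OF q i one] i one by (simp add: mult_ac)
    then show ?thesis using D[OF one] by (simp add: field_simps)
  qed (use D[OF one] in simp)
  show ?R
  proof (intro exI ballI)
    fix i j assume "i \<in> {1..N}" "j \<in> {1..N} - {i}"
    then show "m i * m j * ?S i j = l 1 / ?D 1 * ?D i * ?D j"
      unfolding K[OF \<open>i \<in> {1..N}\<close>, symmetric] by (rule l)
  qed
qed

section \<open>Elimination of the constant \<open>K\<close>\<close>

text \<open>In terms of \<open>a i = D i / m i\<close> the left side reads
  \<open>S i j = K * a i * a j\<close>, a rank one pattern off the diagonal. The equations of the
  system compare such products. Conversely they rebuild the pattern from row 1, then column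
  \<open>N\<close>, then the remaining entries.\<close>

lemma product_form_iff_system:
  fixes S :: "nat \<Rightarrow> nat \<Rightarrow> real" and D m :: "nat \<Rightarrow> real"
  assumes N: "N \<ge> 3" and m: "\<And>i. i \<in> {1..N} \<Longrightarrow> m i > 0"
    and sym: "\<And>i j. i \<in> {1..N} \<Longrightarrow> j \<in> {1..N} \<Longrightarrow> S j i = S i j"
    and nz: "\<And>i j. i \<in> {1..N} \<Longrightarrow> j \<in> {1..N} \<Longrightarrow> i \<noteq> j \<Longrightarrow> S i j \<noteq> 0"
  shows "(\<exists>K. \<forall>i\<in>{1..N}. \<forall>j\<in>{1..N} - {i}. m i * m j * S i j = K * D i * D j) \<longleftrightarrow>
    D N \<noteq> 0 \<and>
    (\<forall>k\<in>{2..N-1}. m k = (S 1 N * D k) / (S 1 k * D N) * m N) \<and>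
    m 1 = (S 2 N * D 1) / (S 1 2 * D N) * m N \<and>
    (\<forall>j\<in>{3..N-1}. S 1 j * S 2 N = S 1 2 * S j N) \<and>
    (\<forall>j\<in>{2..N-2}. \<forall>k\<in>{j+1..N-1}. S j k * S 1 N = S 1 k * S j N)"
    (is "?L \<longleftrightarrow> ?R")
proof
  assume ?L
  then obtain K where K: "\<And>i j. i \<in> {1..N} \<Longrightarrow> j \<in> {1..N} - {i} \<Longrightarrow> m i * m j * S i j = K * D i * D j"
    by blast
  define a where "a i = D i / m i" for i
  have S: "S i j = K * a i * a j" if "i \<in> {1..N}" "j \<in> {1..N}" "i \<noteq> j" for i j
    using K[of i j] m[of i] m[of j] that by (simp add: a_def field_simps)
  have K0: "K \<noteq> 0" using S[of 1 2] nz[of 1 2] N by auto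
  have a0: "a i \<noteq> 0" if i: "i \<in> {1..N}" for i
  proof -
    obtain j where "j \<in> {1..N}" "i \<noteq> j"
      by (rule that[of "if i = 1 then 2 else 1"]) (use N in auto)
    with S[of i j] nz[of i j] i show ?thesis by auto
  qed
  have D: "D i = a i * m i" if "i \<in> {1..N}" for i using m[OF that] by (simp add: a_def)
  \<comment> \<open>Dividing \<open>S i N\<close> by \<open>S i k\<close> cancels
    \<open>K * a i\<close> for any reference body \<open>i\<close>. The system takes
    \<open>i = 1\<close>, except for \<open>m 1\<close>, where the diagonal must be avoided and
    \<open>i = 2\<close> serves.\<close>
  have mass: "m k = (S i N * D k) / (S i k * D N) * m N"
    if "i \<in> {1..N-1}" "k \<in> {1..N}" "i \<noteq> k" for i k
  proof -
    have iN: "i \<in> {1..N}" "N \<in> {1..N}" "i \<noteq> N" using that N by auto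
    show ?thesis
      using K0 a0[of i] a0[of k] a0[of N] m[of N] that iN
      by (simp add: S[of i N] S[of i k] D[of k] D[of N])
  qed
  show ?R
  proof (intro conjI ballI)
    show "D N \<noteq> 0" using a0[of N] N by (auto simp: a_def)
    show "m k = S 1 N * D k / (S 1 k * D N) * m N" if "k \<in> {2..N-1}" for k
      by (rule mass) (use that N in auto)
    show "m 1 = S 2 N * D 1 / (S 1 2 * D N) * m N"
      using mass[of 2 1] sym[of 1 2] N by simp
    show "S 1 j * S 2 N = S 1 2 * S j N" if "j \<in> {3..N-1}" for j
    proof -
      have "S 1 j = K * a 1 * a j" "S 2 N = K * a 2 * a N" "S 1 2 = K * a 1 * a 2" "S j N = K * a j * a N"
        by (rule S; use that N in auto)+
      then show ?thesis by (simp only: mult_ac)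
    qed
    show "S j k * S 1 N = S 1 k * S j N" if "j \<in> {2..N-2}" "k \<in> {j+1..N-1}" for j k
    proof -
      have "S j k = K * a j * a k" "S 1 N = K * a 1 * a N" "S 1 k = K * a 1 * a k" "S j N = K * a j * a N"
        by (rule S; use that N in auto)+
      then show ?thesis by (simp only: mult_ac)
    qed
  qed
next
  assume R: ?R
  define a where "a i = D i / m i" for i
  have inN: "1 \<in> {1..N}" "2 \<in> {1..N}" "N \<in> {1..N}" "1 \<noteq> N" "2 \<noteq> N" using N by auto
  have m0: "m i \<noteq> 0" if "i \<in> {1..N}" for i using m[OF that] by simp
  \<comment> \<open>The system asserts only \<open>D N \<noteq> 0\<close>; for other bodies the
    positive mass is an expression with factor \<open>D i\<close>.\<close>
  have D0: "D i \<noteq> 0" if i: "i \<in> {1..N}" for i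
  proof -
    consider "i = 1" | "i \<in> {2..N-1}" | "i = N" using i unfolding atLeastAtMost_iff by arith
    then show ?thesis
    proof cases
      case 1
      then show ?thesis using R m[OF i] by auto
    next
      case 2
      then have "m i = S 1 N * D i / (S 1 i * D N) * m N" using R by blast
      then show ?thesis using m[OF i] by auto
    qed (use R in simp)
  qed
  have a0: "a i \<noteq> 0" if "i \<in> {1..N}" for i
    using D0[OF that] m[OF that] by (simp add: a_def)
  \<comment> \<open>The pair of bodies 1 and \<open>N\<close> fixes the constant.\<close>
  define K where "K = S 1 N / (a 1 * a N)"
  have one: "S 1 k = K * a 1 * a k" if k: "k \<in> {2..N}" for k
  proof (cases "k = N")
    case True
    then show ?thesis using a0[OF inN(1)] a0[OF inN(3)] by (simp add: K_def)
  next
    case False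
    then have k': "k \<in> {2..N-1}" "k \<in> {1..N}" "1 \<noteq> k" using k by auto
    have "m k = S 1 N * D k / (S 1 k * D N) * m N" using R k' by blast
    then have "m k * S 1 k * D N = S 1 N * D k * m N"
      using nz[OF inN(1) k'(2,3)] D0[OF inN(3)] by simp
    then have "S 1 k = S 1 N * a k / a N"
      using D0[OF inN(3)] m0[OF k'(2)] m0[OF inN(3)] by (simp add: a_def field_simps)
    then show ?thesis using a0[OF inN(1)] by (simp add: K_def)
  qed
  \<comment> \<open>The equation for \<open>m 1\<close> supplies the entry of column
    \<open>N\<close> that the equations for \<open>j\<close> from 3 on start from.\<close>
  have two: "S 2 N = K * a 2 * a N"
  proof -
    have "m 1 = S 2 N * D 1 / (S 1 2 * D N) * m N" using R by blast
    then have "m 1 * S 1 2 * D N = S 2 N * D 1 * m N"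
      using nz[OF inN(1,2)] D0[OF inN(3)] by simp
    then have "S 1 2 * a N = S 2 N * a 1"
      using D0[OF inN(3)] m0[OF inN(1)] m0[OF inN(3)] by (simp add: a_def field_simps)
    then show ?thesis using one[of 2] a0[OF inN(1)] N by (simp add: field_simps)
  qed
  have K0: "K \<noteq> 0" using one[of N] nz[OF inN(1,3,4)] N by auto
  \<comment> \<open>For \<open>j\<close> from 3 on, \<open>S j N\<close> is obtained by cancelling
    the nonzero entry \<open>S 1 2\<close>.\<close>
  have last: "S j N = K * a j * a N" if j: "j \<in> {1..N-1}" for j
  proof -
    consider "j = 1" | "j = 2" | "j \<in> {3..N-1}" using j unfolding atLeastAtMost_iff by arith
    then show ?thesis
    proof cases
      case 3
      then have "S 1 j * S 2 N = S 1 2 * S j N" using R by blast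
      moreover have "S 1 2 = K * a 1 * a 2" "S 1 j = K * a 1 * a j"
        by (rule one; use 3 N in auto)+
      ultimately have "(K * a 1 * a 2) * S j N = (K * a 1 * a 2) * (K * a j * a N)"
        using two by (simp only: mult_ac)
      then show ?thesis using K0 a0[OF inN(1)] a0[OF inN(2)] by simp
    qed (use one[of N] two N in auto)
  qed
  \<comment> \<open>An entry outside row 1 and column \<open>N\<close> is determined by them:
    \<open>S i j = S 1 j * S i N / S 1 N\<close>.\<close>
  have less: "S i j = K * a i * a j" if ij: "i \<in> {1..N}" "j \<in> {1..N}" "i < j" for i j
  proof -
    consider "i = 1" | "j = N" | "i \<in> {2..N-2}" "j \<in> {i+1..N-1}" using ij unfolding atLeastAtMost_iff by arith
    then show ?thesis
    proof cases
      case 3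
      then have "S i j * S 1 N = S 1 j * S i N" using R by blast
      moreover have "S 1 N = K * a 1 * a N" "S 1 j = K * a 1 * a j"
        by (rule one; use 3 N in auto)+
      moreover have "S i N = K * a i * a N" by (rule last) (use 3 in auto)
      ultimately have "(K * a 1 * a N) * S i j = (K * a 1 * a N) * (K * a i * a j)"
        by (simp only: mult_ac)
      then show ?thesis using K0 a0[OF inN(1)] a0[OF inN(3)] by simp
    qed (use one[of j] last[of i] ij in auto)
  qed
  have "m i * m j * S i j = K * D i * D j" if ij: "i \<in> {1..N}" "j \<in> {1..N} - {i}" for i j
  proof -
    have "S i j = K * a i * a j"
      using less[of i j] less[of j i] sym[of i j] ij by (cases "i < j") auto
    then show ?thesis using m[of i] m[of j] ij by (simp add: a_def field_simps)
  qed
  then show ?L by blast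
qed

theorem theorem3:
  fixes N :: nat and m :: "nat \<Rightarrow> real" and G :: "real \<Rightarrow> real" and q :: "nat \<Rightarrow> real vec"
  assumes "N \<ge> 3"
    and "\<forall>i\<in>{1..N}. m i > 0"
    and "smooth_on_0_pi G"
    and "attractive G \<or> repulsive G"
    and "q \<in> config_space N"
    and "dziobek N q"
  shows "equilibrium N m G q \<longleftrightarrow>
    Delta N q N \<noteq> 0 \<and>
    (\<forall>k\<in>{2..N-1}. m k = (S_coeff G q 1 N * Delta N q k) / (S_coeff G q 1 k * Delta N q N) * m N) \<and>
    m 1 = (S_coeff G q 2 N * Delta N q 1) / (S_coeff G q 1 2 * Delta N q N) * m N \<and>
    (\<forall>j\<in>{3..N-1}. S_coeff G q 1 j * S_coeff G q 2 N = S_coeff G q 1 2 * S_coeff G q j N) \<and>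
    (\<forall>j\<in>{2..N-2}. \<forall>k\<in>{j+1..N-1}. S_coeff G q j k * S_coeff G q 1 N = S_coeff G q 1 k * S_coeff G q j N)"
proof -
  have "N \<ge> 2" using assms(1) by simp
  from equilibrium_iff_product_form[OF this assms(2-6)]
    product_form_iff_system[OF assms(1), of m "S_coeff G q" "Delta N q"]
    assms(2) S_coeff_commute[OF assms(5)] S_coeff_nonzero[OF assms(4,5)]
  show ?thesis by simp
qed

end
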